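(* Suppose that $\Sigma$ is a simplicial and complete locally convex fan of dimension $d\ge4$, that $\tau=\sigma\cap\sigma'$ is a wall of $\Sigma$ and $\alpha\in\tau(1)$ is a ray with $D_\alpha\cdot V_\Sigma(\tau)=0$. Let $\alpha'\in\Sigma(1)$ be the unique ray with the following properties: substituting $\alpha'$ for $\alpha$ in $\sigma$ and $\sigma'$ yields cones of $\Sigma$; $V_\Sigma(\tau')\in\mathbb R_+[V_\Sigma(\tau)]$, where $\tau'=\operatorname{Cone}(\tau\setminus\alpha,\alpha')$; and $\alpha$, $\sigma\setminus\tau$, $\alpha'$, $\sigma'\setminus\tau$ form an induced 4-cycle in $\Sigma$. Then $D_{\alpha'}\cdot V_\Sigma(\tau')=0$.
   Context: A fan is locally convex if for every ray $\rho$ the union of all cones containing $\rho$ is convex. $\tau(1)$ is the set of rays of $\tau$; $D_\alpha$ is the torus-invariant divisor of $\alpha$; $V_\Sigma(\tau)$ is the orbit closure (a curve) of the $(d-1)$-dimensional cone $\tau$, $[V_\Sigma(\tau)]$ its numerical class. $\sigma\setminus\tau$ is the unique ray of the maximal cone $\sigma$ not in $\tau$, and $\tau\setminus\alpha$ the face of $\tau$ spanned by the rays other than $\alpha$. Rays $v_1,v_2,v_3,v_4$ form an induced 4-cycle if $\operatorname{Cone}(v_i,v_{i+1})\in\Sigma$ for $1\le i\le4$ ($v_5=v_1$) and $\operatorname{Cone}(v_1,v_3),\operatorname{Cone}(v_2,v_4)\notin\Sigma$. *)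

theory Defs
  imports "HOL-Analysis.Analysis"
begin

(* The lattice N is Z^d inside N_R = R^d, where d = CARD('n).  The dual M_R is identified with
   R^d through the inner product. *)

definition lattice_points :: "(real ^ 'n) set" where
  "lattice_points = {x. \<forall>i. x $ i \<in> \<int>}"

definition Cone :: "(real ^ 'n) set set \<Rightarrow> (real ^ 'n) set" where
  "Cone \<S> = convex_cone hull (\<Union>\<S>)"

definition rational_cone :: "(real ^ 'n) set \<Rightarrow> bool" where
  "rational_cone \<sigma> \<longleftrightarrow>
     (\<exists>S. finite S \<and> S \<subseteq> lattice_points \<and> \<sigma> = convex_cone hull S)"

definition strongly_convex :: "(real ^ 'n) set \<Rightarrow> bool" where
  "strongly_convex \<sigma> \<longleftrightarrow> \<sigma> \<inter> uminus ` \<sigma> = {0}"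

(* The library relation "face_of" counts the empty set as a face; a face of a cone is not empty. *)
definition is_fan :: "(real ^ 'n) set set \<Rightarrow> bool" where
  "is_fan \<Sigma> \<longleftrightarrow>
     finite \<Sigma> \<and>
     (\<forall>\<sigma>\<in>\<Sigma>. rational_cone \<sigma> \<and> strongly_convex \<sigma>) \<and>
     (\<forall>\<sigma>\<in>\<Sigma>. \<forall>\<phi>. \<phi> face_of \<sigma> \<and> \<phi> \<noteq> {} \<longrightarrow> \<phi> \<in> \<Sigma>) \<and>
     (\<forall>\<sigma>\<in>\<Sigma>. \<forall>\<sigma>'\<in>\<Sigma>. (\<sigma> \<inter> \<sigma>') face_of \<sigma> \<and> (\<sigma> \<inter> \<sigma>') face_of \<sigma>')"

(* The set sigma(1) of rays of a cone, and the set Sigma(1) of rays of a fan. *)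
definition cone_rays :: "(real ^ 'n) set \<Rightarrow> (real ^ 'n) set set" where
  "cone_rays \<sigma> = {\<rho>. \<rho> face_of \<sigma> \<and> dim \<rho> = 1}"

definition fan_rays :: "(real ^ 'n) set set \<Rightarrow> (real ^ 'n) set set" where
  "fan_rays \<Sigma> = {\<rho>\<in>\<Sigma>. dim \<rho> = 1}"

definition max_cones :: "(real ^ 'n) set set \<Rightarrow> (real ^ 'n) set set" where
  "max_cones \<Sigma> = {\<sigma>\<in>\<Sigma>. dim \<sigma> = CARD('n)}"

definition walls :: "(real ^ 'n) set set \<Rightarrow> (real ^ 'n) set set" where
  "walls \<Sigma> = {\<tau>\<in>\<Sigma>. dim \<tau> + 1 = CARD('n)}"

definition ray_gen :: "(real ^ 'n) set \<Rightarrow> real ^ 'n" where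
  "ray_gen \<rho> = (THE u. u \<in> \<rho> \<inter> lattice_points \<and> u \<noteq> 0 \<and>
     (\<forall>v \<in> \<rho> \<inter> lattice_points. \<exists>k::nat. v = real k *\<^sub>R u))"

definition simplicial_fan :: "(real ^ 'n) set set \<Rightarrow> bool" where
  "simplicial_fan \<Sigma> \<longleftrightarrow> (\<forall>\<sigma>\<in>\<Sigma>. independent (ray_gen ` cone_rays \<sigma>))"

definition complete_fan :: "(real ^ 'n) set set \<Rightarrow> bool" where
  "complete_fan \<Sigma> \<longleftrightarrow> \<Union>\<Sigma> = UNIV"

definition locally_convex_fan :: "(real ^ 'n) set set \<Rightarrow> bool" where
  "locally_convex_fan \<Sigma> \<longleftrightarrow>
     (\<forall>\<rho>\<in>fan_rays \<Sigma>. convex (\<Union>{\<sigma>\<in>\<Sigma>. \<rho> \<subseteq> \<sigma>}))"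

(* sigma \ tau for a facet tau of a simplicial cone sigma *)
definition opposite_ray :: "(real ^ 'n) set \<Rightarrow> (real ^ 'n) set \<Rightarrow> (real ^ 'n) set" where
  "opposite_ray \<sigma> \<tau> = (THE \<rho>. \<rho> \<in> cone_rays \<sigma> - cone_rays \<tau>)"

(* tau \ alpha *)
definition opposite_face :: "(real ^ 'n) set \<Rightarrow> (real ^ 'n) set \<Rightarrow> (real ^ 'n) set" where
  "opposite_face \<tau> \<alpha> = Cone (cone_rays \<tau> - {\<alpha>})"

definition substitute_ray ::
  "(real ^ 'n) set \<Rightarrow> (real ^ 'n) set \<Rightarrow> (real ^ 'n) set \<Rightarrow> (real ^ 'n) set" where
  "substitute_ray \<sigma> \<alpha> \<alpha>' = Cone (insert \<alpha>' (cone_rays \<sigma> - {\<alpha>}))"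

(* The v_i are automatically distinct, because Cone {v, v} = v for a ray v. *)
definition induced_4_cycle ::
  "(real ^ 'n) set set \<Rightarrow> (real ^ 'n) set \<Rightarrow> (real ^ 'n) set \<Rightarrow> (real ^ 'n) set
     \<Rightarrow> (real ^ 'n) set \<Rightarrow> bool" where
  "induced_4_cycle \<Sigma> v1 v2 v3 v4 \<longleftrightarrow>
     {v1, v2, v3, v4} \<subseteq> fan_rays \<Sigma> \<and>
     Cone {v1, v2} \<in> \<Sigma> \<and> Cone {v2, v3} \<in> \<Sigma> \<and> Cone {v3, v4} \<in> \<Sigma> \<and> Cone {v4, v1} \<in> \<Sigma> \<and>
     Cone {v1, v3} \<notin> \<Sigma> \<and> Cone {v2, v4} \<notin> \<Sigma>"

(* A torus-invariant R-divisor on the toric variety of the fan is given by its coefficients at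
   the prime divisors D_rho; coefficients at sets that are not rays of the fan are 0. *)
type_synonym 'n divisor = "(real ^ 'n) set \<Rightarrow> real"

definition torus_divisors :: "(real ^ 'n) set set \<Rightarrow> 'n divisor set" where
  "torus_divisors \<Sigma> = {D. \<forall>\<rho>. \<rho> \<notin> fan_rays \<Sigma> \<longrightarrow> D \<rho> = 0}"

definition ray_divisor :: "(real ^ 'n) set \<Rightarrow> 'n divisor" where
  "ray_divisor \<alpha> = (\<lambda>\<rho>. if \<rho> = \<alpha> then 1 else 0)"

(* On the affine chart of sigma the divisor D is the divisor of the character -m(sigma).  The
   m(sigma) lie in M_R, so this describes R-Cartier divisors. *)
definition Cartier_data ::
  "(real ^ 'n) set set \<Rightarrow> 'n divisor \<Rightarrow> ((real ^ 'n) set \<Rightarrow> real ^ 'n) \<Rightarrow> bool" where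
  "Cartier_data \<Sigma> D m \<longleftrightarrow>
     (\<forall>\<sigma>\<in>max_cones \<Sigma>. \<forall>\<rho>\<in>cone_rays \<sigma>. m \<sigma> \<bullet> ray_gen \<rho> = - D \<rho>)"

definition Cartier_divisors :: "(real ^ 'n) set set \<Rightarrow> 'n divisor set" where
  "Cartier_divisors \<Sigma> = {D \<in> torus_divisors \<Sigma>. \<exists>m. Cartier_data \<Sigma> D m}"

(* u is a lattice point of sigma' whose image in N(tau) = N / (N \<inter> span tau) is the primitive
   generator of the ray which is the image of sigma'. *)
definition lifts_quotient_gen ::
  "(real ^ 'n) set \<Rightarrow> (real ^ 'n) set \<Rightarrow> real ^ 'n \<Rightarrow> bool" where
  "lifts_quotient_gen \<sigma>' \<tau> u \<longleftrightarrow>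
     u \<in> \<sigma>' \<inter> lattice_points \<and> u \<notin> span \<tau> \<and>
     (\<forall>v \<in> \<sigma>' \<inter> lattice_points. \<exists>k::nat. v - real k *\<^sub>R u \<in> span \<tau>)"

(* The intersection number D . V(tau) of an R-Cartier divisor D with the curve V(tau), for a wall
   tau of a complete fan: the degree of O(D) on V(tau), which is a projective line.  If tau is the
   intersection of the maximal cones sigma and sigma', the fan of V(tau) in N(tau)_R consists of
   0 and the images of sigma and sigma'.  The restriction of O(D) has transition function the
   character m(sigma) - m(sigma'), which is trivial on span tau; its degree is the order of this
   character at the fixed point of sigma', i.e. its value on u
   (Cox, Little, Schenck, Toric Varieties, Proposition 6.3.8). *)
definition intersection_number ::
  "(real ^ 'n) set set \<Rightarrow> 'n divisor \<Rightarrow> (real ^ 'n) set \<Rightarrow> real" where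
  "intersection_number \<Sigma> D \<tau> =
     (THE x. \<exists>\<sigma>\<in>max_cones \<Sigma>. \<exists>\<sigma>'\<in>max_cones \<Sigma>. \<exists>m u.
        \<sigma> \<noteq> \<sigma>' \<and> \<tau> = \<sigma> \<inter> \<sigma>' \<and> Cartier_data \<Sigma> D m \<and> lifts_quotient_gen \<sigma>' \<tau> u \<and>
        x = (m \<sigma> - m \<sigma>') \<bullet> u)"

(* The class of V(tau) modulo numerical equivalence, as the functional D |-> D . V(tau).  Torus-
   invariant divisors suffice, since every Cartier divisor on a toric variety is linearly
   equivalent to a torus-invariant one. *)
definition curve_class :: "(real ^ 'n) set set \<Rightarrow> (real ^ 'n) set \<Rightarrow> 'n divisor \<Rightarrow> real" where
  "curve_class \<Sigma> \<tau> =
     (\<lambda>D. if D \<in> Cartier_divisors \<Sigma> then intersection_number \<Sigma> D \<tau> else 0)"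

definition nonneg_multiples :: "('a \<Rightarrow> real) \<Rightarrow> ('a \<Rightarrow> real) set" where
  "nonneg_multiples c = {\<lambda>x. t * c x | t. t \<ge> 0}"

end

(* The divisor of alpha' restricts trivially to V(tau): a maximal cone containing tau has alpha as
   a ray, so it cannot also have alpha' as a ray, since all faces of a simplicial cone of Sigma lie
   in Sigma whereas Cone(alpha, alpha') does not.  Hence the local equations of the divisor of
   alpha' along V(tau) vanish and its degree on V(tau) is 0.  As [V(tau')] is a multiple of
   [V(tau)], the degree on V(tau') is 0 as well. *)

theory Submission
  imports Defs
begin

section \<open>Finitely generated cones and the faces of simplicial cones\<close>

lemma convex_cone_hull_finite:
  fixes B :: "'a::real_vector set"
  assumes "finite B"
  shows "convex_cone hull B = {\<Sum>b\<in>B. c b *\<^sub>R b | c. \<forall>b\<in>B. 0 \<le> c b}" (is "_ = ?R")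
proof
  have cc: "convex_cone ?R"
    unfolding convex_cone_iff
  proof (intro conjI allI impI ballI)
    show "0 \<in> ?R" by (auto intro!: exI[of _ "\<lambda>_. 0"])
  next
    fix x y assume "x \<in> ?R" "y \<in> ?R"
    then obtain c d where "x = (\<Sum>b\<in>B. c b *\<^sub>R b)" "\<forall>b\<in>B. 0 \<le> c b"
      "y = (\<Sum>b\<in>B. d b *\<^sub>R b)" "\<forall>b\<in>B. 0 \<le> d b" by blast
    then show "x + y \<in> ?R"
      by (intro CollectI exI[of _ "\<lambda>b. c b + d b"]) (simp add: sum.distrib scaleR_add_left)
  next
    fix x and t :: real assume "x \<in> ?R" "0 \<le> t"
    then obtain c where "x = (\<Sum>b\<in>B. c b *\<^sub>R b)" "\<forall>b\<in>B. 0 \<le> c b" by blast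
    with \<open>0 \<le> t\<close> show "t *\<^sub>R x \<in> ?R"
      by (intro CollectI exI[of _ "\<lambda>b. t * c b"]) (simp add: scaleR_sum_right)
  qed
  have "b \<in> ?R" if "b \<in> B" for b
    using that assms
    by (intro CollectI exI[of _ "\<lambda>x. if x = b then 1 else 0"]) (simp add: if_distrib [of "\<lambda>t. t *\<^sub>R _"] cong: if_cong)
  then show "convex_cone hull B \<subseteq> ?R"
    by (intro hull_minimal cc subsetI)
next
  have "(\<Sum>b\<in>B. c b *\<^sub>R b) \<in> convex_cone hull B" if "\<forall>b\<in>B. 0 \<le> c b" for c
    using assms order_refl[of B]
  \<comment> \<open>The ambient set in this induction stays the original \<open>B\<close>, on all of
    which \<open>c\<close> is nonnegative; only the summation set and the hull grow.\<close>
  proof (induction B rule: finite_subset_induct')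
    case empty
    show ?case by (simp add: convex_cone_hull_contains_0)
  next
    case (insert a F)
    then show ?case
      using that
      by (auto intro!: convex_cone_hull_add convex_cone_hull_mul intro: hull_inc
          subsetD[OF hull_mono[OF subset_insertI]])
  qed
  then show "?R \<subseteq> convex_cone hull B" by blast
qed

lemma convex_cone_hull_singleton: "convex_cone hull {s} = {t *\<^sub>R s | t. 0 \<le> t}"
  by (subst convex_cone_hull_finite) (auto intro: exI[of _ "\<lambda>_. _"])

lemma convex_cone_hull_subset_span: "convex_cone hull S \<subseteq> span S"
  by (simp add: convex_cone_span hull_minimal span_superset)

lemma span_convex_cone_hull: "span (convex_cone hull S) = span S"
  by (metis convex_cone_hull_subset_span hull_subset span_mono span_span subset_antisym)

text \<open>Independence lets a linear functional take any values on \<open>B\<close>, and its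
  adjoint at 1 is the vector representing it. Such vectors serve below as supporting normals, dual
  basis vectors and local Cartier data.\<close>

lemma independent_prescribed_inner:
  fixes B :: "'a::euclidean_space set"
  assumes "independent B"
  obtains m where "\<And>b. b \<in> B \<Longrightarrow> m \<bullet> b = f b"
proof -
  obtain g :: "'a \<Rightarrow> real" where g: "linear g" "\<forall>b\<in>B. g b = f b"
    using linear_independent_extend[OF assms] by blast
  have "adjoint g 1 \<bullet> b = g b" for b
    using adjoint_works[OF g(1), of b 1] by (simp add: inner_commute)
  with g(2) show thesis by (intro that[of "adjoint g 1"]) simp
qed

text \<open>Choose \<open>m\<close> to be 0 on \<open>A\<close> and -1 on the rest of
  \<open>B\<close>. Then \<open>m\<close> is nonpositive on the whole cone, and a nonnegative
  combination lies in the hyperplane \<open>m \<bullet> x = 0\<close> exactly when its coefficients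
  outside \<open>A\<close> vanish. So this supporting hyperplane cuts out the cone over
  \<open>A\<close>.\<close>

lemma convex_cone_hull_face_of:
  fixes B :: "'a::euclidean_space set"
  assumes "independent B" "A \<subseteq> B"
  shows "convex_cone hull A face_of convex_cone hull B"
proof -
  have fin: "finite B" using assms(1) independent_bound by blast
  obtain m where m: "\<And>b. b \<in> B \<Longrightarrow> m \<bullet> b = (if b \<in> A then 0 else -1)"
    using independent_prescribed_inner[OF assms(1), where f = "\<lambda>b. if b \<in> A then 0 else -1"] by blast
  have val: "m \<bullet> (\<Sum>b\<in>B. c b *\<^sub>R b) = - (\<Sum>b\<in>B-A. c b)" for c
  proof -
    have "m \<bullet> (\<Sum>b\<in>B. c b *\<^sub>R b) = (\<Sum>b\<in>B. if b \<in> A then 0 else - c b)"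
      unfolding inner_sum_right by (rule sum.cong) (auto simp: m)
    also have "\<dots> = (\<Sum>b\<in>B-A. - c b)"
      by (rule sum.mono_neutral_cong_right) (auto simp: fin)
    finally show ?thesis by (simp add: sum_negf)
  qed
  have "m \<bullet> x \<le> 0" if "x \<in> convex_cone hull B" for x
    using that unfolding convex_cone_hull_finite[OF fin] by (auto simp: val intro!: sum_nonneg)
  then have "(convex_cone hull B \<inter> {x. m \<bullet> x = 0}) face_of convex_cone hull B"
    by (intro face_of_Int_supporting_hyperplane_le convex_convex_cone_hull)
  moreover have "convex_cone hull B \<inter> {x. m \<bullet> x = 0} = convex_cone hull A"
  proof
    show "convex_cone hull B \<inter> {x. m \<bullet> x = 0} \<subseteq> convex_cone hull A"
    proof
      fix x assume "x \<in> convex_cone hull B \<inter> {x. m \<bullet> x = 0}"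
      then obtain c where c: "x = (\<Sum>b\<in>B. c b *\<^sub>R b)" "\<forall>b\<in>B. 0 \<le> c b" "m \<bullet> x = 0"
        unfolding convex_cone_hull_finite[OF fin] by blast
      then have "(\<Sum>b\<in>B-A. c b) = 0" by (simp add: val)
      then have "\<forall>b\<in>B-A. c b = 0"
        using c(2) fin by (subst (asm) sum_nonneg_eq_0_iff) auto
      then have "x = (\<Sum>b\<in>A. c b *\<^sub>R b)"
        unfolding c(1) using fin assms(2) by (intro sum.mono_neutral_right) auto
      with c(2) assms(2) show "x \<in> convex_cone hull A"
        unfolding convex_cone_hull_finite[OF finite_subset[OF assms(2) fin]] by blast
    qed
    have "A \<subseteq> {x. m \<bullet> x = 0}" using m assms(2) by auto
    moreover have "convex_cone {x. m \<bullet> x = 0}"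
      by (simp add: convex_cone_iff inner_simps)
    ultimately show "convex_cone hull A \<subseteq> convex_cone hull B \<inter> {x. m \<bullet> x = 0}"
      using assms(2) by (simp add: hull_minimal hull_mono)
  qed
  ultimately show ?thesis by simp
qed

section \<open>Lattice points and generators of quotient lattices\<close>

lemma lattice_points_diff: "x \<in> lattice_points \<Longrightarrow> y \<in> lattice_points \<Longrightarrow> x - y \<in> lattice_points"
  by (simp add: lattice_points_def)

lemma lattice_points_scaleR: "x \<in> lattice_points \<Longrightarrow> t \<in> \<int> \<Longrightarrow> t *\<^sub>R x \<in> lattice_points"
  by (simp add: lattice_points_def)

lemma lattice_points_sum: "(\<And>i. i \<in> I \<Longrightarrow> f i \<in> lattice_points) \<Longrightarrow> sum f I \<in> lattice_points"
  by (auto simp: lattice_points_def intro!: Ints_sum)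

text \<open>Every coordinate of such a point is an integer of absolute value at most a common norm
  bound, so only finitely many coordinate functions occur.\<close>

lemma finite_lattice_points_bounded:
  assumes "bounded (P :: (real ^ 'n) set)"
  shows "finite (P \<inter> lattice_points)"
proof -
  obtain r where r: "\<And>x. x \<in> P \<Longrightarrow> norm x \<le> r" using assms bounded_iff by blast
  define Z where "Z = {t \<in> \<int>. \<bar>t\<bar> \<le> r}"
  have "finite Z"
    unfolding Z_def using finite_abs_int_segment by blast
  have "P \<inter> lattice_points \<subseteq> vec_lambda ` (UNIV \<rightarrow>\<^sub>E Z)"
  proof
    fix x assume x: "x \<in> P \<inter> lattice_points"
    have "\<bar>x $ i\<bar> \<le> r" for i using x component_le_norm_cart[of x i] r[of x] by auto
    then have "vec_nth x \<in> UNIV \<rightarrow>\<^sub>E Z" using x by (auto simp: Z_def lattice_points_def)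
    then show "x \<in> vec_lambda ` (UNIV \<rightarrow>\<^sub>E Z)" by (metis image_eqI vec_nth_inverse)
  qed
  moreover have "finite (vec_lambda ` (UNIV \<rightarrow>\<^sub>E Z))"
    using \<open>finite Z\<close> by (intro finite_imageI finite_PiE) auto
  ultimately show ?thesis by (rule finite_subset)
qed

text \<open>With \<open>B\<close> the ray generators of a maximal cone and \<open>B - {b0}\<close>
  those of a wall, \<open>u\<close> is a lift as required by \<open>lifts_quotient_gen\<close>. With
  \<open>B\<close> a singleton, \<open>u\<close> is the primitive generator of a ray. As
  \<open>B\<close> need not be a lattice basis, \<open>b0\<close> itself may fail to be such a
  lift.\<close>

lemma exists_lift_of_quotient_generator:
  fixes B :: "(real ^ 'n) set"
  assumes ind: "independent B" and lat: "B \<subseteq> lattice_points" and b0: "b0 \<in> B"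
  obtains u where "u \<in> convex_cone hull B" "u \<in> lattice_points" "u \<notin> span (B - {b0})"
    "\<And>v. v \<in> convex_cone hull B \<inter> lattice_points \<Longrightarrow> \<exists>k::nat. v - real k *\<^sub>R u \<in> span (B - {b0})"
proof -
  have fin: "finite B" using ind independent_bound by blast
  obtain w where w: "\<And>b. b \<in> B \<Longrightarrow> w \<bullet> b = (if b = b0 then 1 else 0)"
    using independent_prescribed_inner[OF ind, where f = "\<lambda>b. if b = b0 then 1 else 0"] by blast
  have val: "w \<bullet> (\<Sum>b\<in>B. c b *\<^sub>R b) = c b0" for c
  proof -
    have "w \<bullet> (\<Sum>b\<in>B. c b *\<^sub>R b) = (\<Sum>b\<in>B. if b = b0 then c b else 0)"
      unfolding inner_sum_right by (rule sum.cong) (auto simp: w)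
    also have "\<dots> = c b0" using fin b0 by simp
    finally show ?thesis .
  qed
  have ker: "x \<in> span (B - {b0})" if x: "x \<in> span B" "w \<bullet> x = 0" for x
  proof -
    obtain c where c: "x = (\<Sum>b\<in>B. c b *\<^sub>R b)" using x(1) span_finite[OF fin] by auto
    then have "c b0 = 0" using x(2) by (simp add: val)
    then have "x = (\<Sum>b\<in>B-{b0}. c b *\<^sub>R b)"
      unfolding c by (intro sum.mono_neutral_right fin) auto
    moreover have "(\<Sum>b\<in>B-{b0}. c b *\<^sub>R b) \<in> span (B - {b0})"
      by (intro span_sum span_scale span_base)
    ultimately show ?thesis by simp
  qed
  have ker': "w \<bullet> x = 0" if "x \<in> span (B - {b0})" for x
    using that by (rule span_induct) (auto simp: subspace_hyperplane w)
  (* The functional w cuts out span (B - {b0}).  A lattice point of the box P with minimal positive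
     value of w does the job: subtracting a multiple of it from v leaves a value below the minimum,
     and reducing the coordinates modulo 1 moves the difference back into P. *)
  define P where "P = {\<Sum>b\<in>B. c b *\<^sub>R b | c. \<forall>b\<in>B. 0 \<le> c b \<and> c b \<le> 1}"
  have "bounded P"
    unfolding bounded_iff
  proof (intro exI ballI)
    fix x assume "x \<in> P"
    then obtain c where c: "x = (\<Sum>b\<in>B. c b *\<^sub>R b)" "\<forall>b\<in>B. 0 \<le> c b \<and> c b \<le> 1"
      unfolding P_def by blast
    show "norm x \<le> (\<Sum>b\<in>B. norm b)"
      unfolding c(1) by (rule sum_norm_le) (use c(2) in \<open>auto intro!: mult_left_le_one_le\<close>)
  qed
  then have finP: "finite (P \<inter> lattice_points)" by (rule finite_lattice_points_bounded)
  define V where "V = ((\<bullet>) w ` (P \<inter> lattice_points)) \<inter> {0<..}"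
  have finV: "finite V" unfolding V_def using finP by blast
  \<comment> \<open>The vector \<open>b0\<close> has value 1 under \<open>w\<close>. Thus
    \<open>V\<close> is nonempty, its minimum \<open>g\<close> exists, and
    \<open>g \<le> 1\<close>.\<close>
  have "b0 \<in> P"
    unfolding P_def using fin b0
    by (intro CollectI exI[of _ "\<lambda>x. if x = b0 then 1 else 0"]) (simp add: if_distrib [of "\<lambda>t. t *\<^sub>R _"] cong: if_cong)
  then have "w \<bullet> b0 \<in> (\<bullet>) w ` (P \<inter> lattice_points)" using b0 lat by blast
  then have "1 \<in> V" using w b0 unfolding V_def by simp
  define g where "g = Min V"
  have "g \<in> V" "g \<le> 1" using finV \<open>1 \<in> V\<close> unfolding g_def by (auto intro: Min_in)
  then obtain u where u: "u \<in> P" "u \<in> lattice_points" "w \<bullet> u = g" "0 < g" unfolding V_def by auto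
  have uB: "u \<in> convex_cone hull B"
    using u(1) unfolding P_def convex_cone_hull_finite[OF fin] by blast
  have "\<exists>k::nat. v - real k *\<^sub>R u \<in> span (B - {b0})" if v: "v \<in> convex_cone hull B \<inter> lattice_points" for v
  proof -
    have "0 \<le> w \<bullet> v"
      using v b0 by (auto simp: convex_cone_hull_finite[OF fin] val)
    define k where "k = nat \<lfloor>w \<bullet> v / g\<rfloor>"
    define x where "x = v - real k *\<^sub>R u"
    have "real k = of_int \<lfloor>w \<bullet> v / g\<rfloor>" using \<open>0 \<le> w \<bullet> v\<close> u(4) by (simp add: k_def)
    then have "real k \<le> w \<bullet> v / g" "w \<bullet> v / g < real k + 1" by linarith+
    then have r: "0 \<le> w \<bullet> x" "w \<bullet> x < g"
      using u(3,4) by (simp_all add: x_def inner_diff_right field_simps)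
    have xs: "x \<in> span B"
      unfolding x_def using v uB convex_cone_hull_subset_span by (blast intro: span_diff span_scale)
    have xl: "x \<in> lattice_points"
      unfolding x_def using v u(2) by (intro lattice_points_diff lattice_points_scaleR) auto
    obtain c where c: "x = (\<Sum>b\<in>B. c b *\<^sub>R b)" using xs span_finite[OF fin] by auto
    define y where "y = (\<Sum>b\<in>B. frac (c b) *\<^sub>R b)"
    have "y = x - (\<Sum>b\<in>B. of_int \<lfloor>c b\<rfloor> *\<^sub>R b)"
      by (simp add: y_def c frac_def scaleR_diff_left sum_subtractf)
    moreover have "(\<Sum>b\<in>B. of_int \<lfloor>c b\<rfloor> *\<^sub>R b) \<in> lattice_points"
      using lat by (intro lattice_points_sum lattice_points_scaleR) auto
    ultimately have "y \<in> lattice_points" using xl by (simp add: lattice_points_diff)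
    moreover have "y \<in> P" unfolding P_def y_def by (auto simp: less_imp_le[OF frac_lt_1])
    \<comment> \<open>Here \<open>w \<bullet> x\<close> is the coefficient \<open>c b0\<close>. It
      is at least 0 and less than \<open>g \<le> 1\<close>, so taking fractional parts leaves it
      unchanged.\<close>
    moreover have "w \<bullet> y = w \<bullet> x"
      using r \<open>g \<le> 1\<close> by (simp add: y_def c val frac_eq)
    ultimately have "w \<bullet> x \<in> V" if "w \<bullet> x \<noteq> 0" using that r unfolding V_def by (auto intro!: image_eqI[of _ _ y])
    then have "w \<bullet> x = 0" using r finV unfolding g_def by (metis Min_le not_le)
    then show ?thesis using ker[OF xs] unfolding x_def by blast
  qed
  with that uB u ker' show thesis by fastforce
qed

section \<open>Primitive generators of rays, and pointed cones generated by their rays\<close>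

text \<open>Strong convexity rules out negative multiples of a nonzero lattice vector
  \<open>s\<close> of the ray, so the ray is the half-line through \<open>s\<close>. The definite
  description in \<open>ray_gen\<close> is then justified: a primitive lattice vector on this
  half-line exists and is unique.\<close>

lemma ray_generator:
  assumes "rational_cone \<rho>" "strongly_convex \<rho>" "dim \<rho> = 1"
  shows "ray_gen \<rho> \<in> lattice_points" "ray_gen \<rho> \<noteq> 0" "\<rho> = convex_cone hull {ray_gen \<rho>}"
proof -
  obtain S where S: "S \<subseteq> lattice_points" "\<rho> = convex_cone hull S"
    using assms(1) unfolding rational_cone_def by blast
  have "dim S = 1" using assms(3) unfolding S(2) by (metis dim_span span_convex_cone_hull)
  then obtain s where s: "s \<in> S" "s \<noteq> 0"
    by (metis dim_eq_0 singletonI subsetI zero_neq_one)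
  have "s \<in> \<rho>" using s S by (simp add: hull_inc)
  have sub: "\<rho> \<subseteq> span {s}"
    using card_ge_dim_independent[of "{s}" \<rho>] s \<open>s \<in> \<rho>\<close> assms(3) by simp
  have cc: "convex_cone \<rho>" using S(2) by (simp add: convex_cone_convex_cone_hull)
  have rho: "\<rho> = convex_cone hull {s}"
  proof
    show "convex_cone hull {s} \<subseteq> \<rho>" using \<open>s \<in> \<rho>\<close> cc by (simp add: hull_minimal)
    show "\<rho> \<subseteq> convex_cone hull {s}"
    proof
      fix x assume "x \<in> \<rho>"
      then obtain t where t: "x = t *\<^sub>R s" using sub by (auto simp: span_singleton)
      have "0 \<le> t"
      proof (rule ccontr)
        assume "\<not> 0 \<le> t"
        then have "(- t) *\<^sub>R s \<in> \<rho>" using convex_cone_scaleR[OF cc, of "- t"] \<open>s \<in> \<rho>\<close> by simp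
        then have "x \<in> \<rho> \<inter> uminus ` \<rho>" using \<open>x \<in> \<rho>\<close> t by force
        then show False
          using assms(2) t s \<open>\<not> 0 \<le> t\<close> unfolding strongly_convex_def by simp
      qed
      then show "x \<in> convex_cone hull {s}" using t by (auto simp: convex_cone_hull_singleton)
    qed
  qed
  \<comment> \<open>For the singleton \<open>{s}\<close> the quotient is by the span of the empty
    set, that is by 0, so membership of the difference in this span is an equation.\<close>
  obtain u where u: "u \<in> \<rho>" "u \<in> lattice_points" "u \<noteq> 0"
    and gen: "\<And>v. v \<in> \<rho> \<inter> lattice_points \<Longrightarrow> \<exists>k::nat. v = real k *\<^sub>R u"
    using exists_lift_of_quotient_generator[of "{s}" s] s S(1) unfolding rho by auto
  have eq: "ray_gen \<rho> = u"
    unfolding ray_gen_def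
  proof (rule the_equality)
    \<comment> \<open>Two candidates are natural multiples of each other; the factors multiply to 1,
      hence both are 1.\<close>
    fix u' assume u': "u' \<in> \<rho> \<inter> lattice_points \<and> u' \<noteq> 0 \<and> (\<forall>v\<in>\<rho> \<inter> lattice_points. \<exists>k::nat. v = real k *\<^sub>R u')"
    obtain k :: nat where k: "u' = real k *\<^sub>R u" using gen u' by blast
    obtain l :: nat where l: "u = real l *\<^sub>R u'" using u u' by blast
    have "u = (real l * real k) *\<^sub>R u" using l[unfolded k] by (simp only: scaleR_scaleR)
    then have "(real l * real k - 1) *\<^sub>R u = 0" by (metis scaleR_diff_left scaleR_one diff_self)
    then have "real (l * k) = real 1" using u(3) by simp
    then have "l * k = 1" by (simp only: of_nat_eq_iff)
    then show "u' = u" using k by simp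
  qed (use u gen in blast)
  show "ray_gen \<rho> \<in> lattice_points" "ray_gen \<rho> \<noteq> 0" using eq u by auto
  obtain t where t: "u = t *\<^sub>R s" "0 < t"
    using u rho by (auto simp: convex_cone_hull_singleton less_le)
  have "s = (1 / t) *\<^sub>R u" using t by simp
  then have "s \<in> convex_cone hull {u}" using t(2) by (auto simp: convex_cone_hull_singleton)
  then have "\<rho> \<subseteq> convex_cone hull {u}"
    unfolding rho by (simp add: hull_minimal convex_cone_convex_cone_hull)
  moreover have "convex_cone hull {u} \<subseteq> \<rho>" using u cc by (simp add: hull_minimal)
  ultimately show "\<rho> = convex_cone hull {ray_gen \<rho>}" using eq by simp
qed

lemma strongly_convex_cone_add_eq_0:
  assumes "convex_cone C" "strongly_convex C" "x \<in> C" "y \<in> C" "x + y = 0"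
  shows "x = 0"
proof -
  have "x \<in> uminus ` C" using assms(4,5) by (metis eq_neg_iff_add_eq_0 imageI)
  then show "x = 0" using assms unfolding strongly_convex_def by blast
qed

lemma convex_cone_hull_insert:
  "convex_cone hull (insert s S) = {a *\<^sub>R s + p | a p. 0 \<le> a \<and> p \<in> convex_cone hull S}"
  using convex_cone_hull_Un[of "{s}" S] by (auto simp: convex_cone_hull_singleton) 

text \<open>In a strongly convex cone a vanishing sum of two elements is trivial. If
  \<open>x + y\<close> lies on the half-line through \<open>s\<close>, comparing coefficients of
  \<open>s\<close> produces such a vanishing sum containing the part \<open>p\<close> of
  \<open>x\<close> that comes from \<open>S\<close>; so \<open>p = 0\<close>.\<close>

lemma minimal_generator_face:
  assumes sc: "strongly_convex (convex_cone hull (insert s S))" and s: "s \<notin> convex_cone hull S"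
  shows "convex_cone hull {s} face_of convex_cone hull (insert s S)" (is "_ face_of ?C")
proof -
  have cc: "convex_cone ?C" by (rule convex_cone_convex_cone_hull)
  have sum: "x \<in> convex_cone hull {s}" if xy: "x \<in> ?C" "y \<in> ?C" "x + y \<in> convex_cone hull {s}" for x y
  proof -
    obtain a p b q where x: "x = a *\<^sub>R s + p" "0 \<le> a" "p \<in> convex_cone hull S"
      and y: "y = b *\<^sub>R s + q" "0 \<le> b" "q \<in> convex_cone hull S"
      using xy(1,2) unfolding convex_cone_hull_insert by blast
    obtain t where t: "x + y = t *\<^sub>R s" using xy(3) by (auto simp: convex_cone_hull_singleton)
    have eq: "p + q = (t - a - b) *\<^sub>R s" using x y t by (simp add: algebra_simps)
    have pq: "p + q \<in> convex_cone hull S" using x y by (simp add: convex_cone_hull_add)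
    have C: "p \<in> ?C" "q \<in> ?C" "s \<in> ?C" using x y hull_mono[of S "insert s S"] by (auto intro: hull_inc)
    \<comment> \<open>A positive coefficient could be divided out, putting \<open>s\<close> into the
      cone over \<open>S\<close>.\<close>
    have "t - a - b \<le> 0"
    proof (rule ccontr)
      assume pos: "\<not> t - a - b \<le> 0"
      then have "(1 / (t - a - b)) *\<^sub>R (p + q) \<in> convex_cone hull S"
        using pq by (intro convex_cone_hull_mul) auto
      then show False using s pos by (simp add: eq)
    qed
    then have "q + (a + b - t) *\<^sub>R s \<in> ?C"
      using C cc by (auto intro!: convex_cone_add convex_cone_scaleR)
    moreover have "p + (q + (a + b - t) *\<^sub>R s) = 0" using eq by (simp add: algebra_simps)
    ultimately have "p = 0" using strongly_convex_cone_add_eq_0[OF cc sc C(1)] by blast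
    then show ?thesis using x by (auto simp: convex_cone_hull_singleton)
  qed
  \<comment> \<open>Faces are defined by open segments. Since both sets are cones, the weighted
    endpoints can be treated as summands and the weight divided out afterwards.\<close>
  have half: "x \<in> convex_cone hull {s}"
    if "x \<in> ?C" "y \<in> ?C" "(1 - u) *\<^sub>R x + u *\<^sub>R y \<in> convex_cone hull {s}" "0 < u" "u < 1" for x y u
  proof -
    have "(1 - u) *\<^sub>R x \<in> convex_cone hull {s}"
      by (rule sum[OF _ _ that(3)]) (use that in \<open>auto intro!: convex_cone_hull_mul\<close>)
    then have "(1 / (1 - u)) *\<^sub>R (1 - u) *\<^sub>R x \<in> convex_cone hull {s}"
      using that by (intro convex_cone_hull_mul[of "(1 - u) *\<^sub>R x"]) auto
    moreover have "(1 / (1 - u)) *\<^sub>R (1 - u) *\<^sub>R x = x" using that by simp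
    ultimately show ?thesis by metis
  qed
  show ?thesis
    unfolding face_of_def
  proof (intro conjI ballI impI)
    show "convex_cone hull {s} \<subseteq> ?C" by (rule hull_mono) simp
    show "convex (convex_cone hull {s})" by (rule convex_convex_cone_hull)
  next
    fix x y z assume "x \<in> ?C" "y \<in> ?C" "z \<in> convex_cone hull {s}" "z \<in> open_segment x y"
    then show "x \<in> convex_cone hull {s}"
      using half[of x y] by (auto simp: in_segment)
  next
    fix x y z assume xy: "x \<in> ?C" "y \<in> ?C" and z: "z \<in> convex_cone hull {s}" "z \<in> open_segment x y"
    then obtain u where "0 < u" "u < 1" "z = (1 - u) *\<^sub>R x + u *\<^sub>R y" by (auto simp: in_segment)
    then show "y \<in> convex_cone hull {s}"
      using half[of y x "1 - u"] xy z by (simp add: add.commute)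
  qed
qed

text \<open>Take a finite generating set of least cardinality. None of its elements lies in the cone
  over the others, so each spans a one-dimensional face.\<close>

lemma pointed_cone_generated_by_rays:
  assumes "finite S" and C: "C = convex_cone hull S" and sc: "strongly_convex C"
  shows "C = convex_cone hull (\<Union>(cone_rays C))"
proof
  define T where "T = arg_min card (\<lambda>T. finite T \<and> C = convex_cone hull T)"
  have T: "finite T" "C = convex_cone hull T"
    and least: "\<And>U. finite U \<Longrightarrow> C = convex_cone hull U \<Longrightarrow> card T \<le> card U"
    using arg_min_nat_lemma[of "\<lambda>T. finite T \<and> C = convex_cone hull T" S card] assms(1) C
    unfolding T_def by auto
  have "t \<in> \<Union>(cone_rays C)" if t: "t \<in> T" for t
  proof -
    have ins: "insert t (T - {t}) = T" using t by blast
    have "t \<notin> convex_cone hull (T - {t})"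
    proof
      assume "t \<in> convex_cone hull (T - {t})"
      then have "convex_cone hull (T - {t}) = C"
        using hull_redundant[of t convex_cone "T - {t}"] ins T(2) by simp
      then have "card T \<le> card (T - {t})" using least T(1) by simp
      then show False using t T(1) by (meson card_Diff1_less not_le)
    qed
    \<comment> \<open>Since 0 lies in every cone hull, an irredundant generator is nonzero.\<close>
    then have "convex_cone hull {t} face_of C" and "t \<noteq> 0"
      using minimal_generator_face[of t "T - {t}"] sc T(2) ins by (auto simp: convex_cone_hull_contains_0)
    moreover have "dim (convex_cone hull {t}) = 1"
      using \<open>t \<noteq> 0\<close> by (metis One_nat_def card.empty card_insert_disjoint dim_eq_card empty_iff finite.emptyI independent_insert
        independent_empty span_convex_cone_hull span_empty singletonD)
    ultimately show ?thesis unfolding cone_rays_def by (auto intro!: exI[of _ "convex_cone hull {t}"] hull_inc)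
  qed
  then show "C \<subseteq> convex_cone hull (\<Union>(cone_rays C))" unfolding T(2) by (metis hull_mono subsetI)
next
  have "\<Union>(cone_rays C) \<subseteq> C" unfolding cone_rays_def using face_of_imp_subset by blast
  then show "convex_cone hull (\<Union>(cone_rays C)) \<subseteq> C"
    unfolding C by (simp add: hull_minimal convex_cone_convex_cone_hull)
qed

section \<open>Cones of a fan and their ray generators\<close>

lemma cone_rays_subset_fan_rays:
  assumes "is_fan \<Sigma>" "\<sigma> \<in> \<Sigma>"
  shows "cone_rays \<sigma> \<subseteq> fan_rays \<Sigma>"
proof
  fix \<rho> assume \<rho>: "\<rho> \<in> cone_rays \<sigma>"
  then have "\<rho> \<noteq> {}" unfolding cone_rays_def by auto
  with \<rho> assms show "\<rho> \<in> fan_rays \<Sigma>"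
    unfolding is_fan_def cone_rays_def fan_rays_def by blast
qed

lemma fan_ray_generator:
  assumes "is_fan \<Sigma>" "\<rho> \<in> fan_rays \<Sigma>"
  shows "ray_gen \<rho> \<in> lattice_points" "\<rho> = convex_cone hull {ray_gen \<rho>}"
  using assms ray_generator[of \<rho>] unfolding is_fan_def fan_rays_def by blast+

lemma inj_on_ray_gen: "is_fan \<Sigma> \<Longrightarrow> inj_on ray_gen (fan_rays \<Sigma>)"
  by (metis fan_ray_generator(2) inj_onI)

text \<open>Each ray is the half-line over its generator, so the rays and their generators generate
  the same cone. This makes linear independence applicable to cones such as
  \<open>Cone {\<alpha>, \<alpha>'}\<close>.\<close>

lemma Cone_eq_hull_ray_gens:
  assumes "is_fan \<Sigma>" "A \<subseteq> fan_rays \<Sigma>"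
  shows "Cone A = convex_cone hull (ray_gen ` A)"
proof -
  have "\<rho> \<subseteq> convex_cone hull (ray_gen ` A)" if "\<rho> \<in> A" for \<rho>
  proof -
    have "\<rho> = convex_cone hull {ray_gen \<rho>}" using fan_ray_generator assms that by blast
    then show ?thesis using that by (metis hull_mono image_eqI singletonD subsetI)
  qed
  moreover have "ray_gen \<rho> \<in> \<rho>" if "\<rho> \<in> A" for \<rho>
    using fan_ray_generator(2)[OF assms(1), of \<rho>] assms(2) that by (metis hull_inc singletonI subsetD)
  ultimately have *: "\<Union>A \<subseteq> convex_cone hull (ray_gen ` A)" "ray_gen ` A \<subseteq> \<Union>A" by blast+
  have "convex_cone hull (\<Union>A) \<subseteq> convex_cone hull (ray_gen ` A)"
    by (rule hull_minimal, rule *(1), rule convex_cone_convex_cone_hull)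
  moreover have "convex_cone hull (ray_gen ` A) \<subseteq> convex_cone hull (\<Union>A)"
    by (rule hull_mono, rule *(2))
  ultimately show ?thesis unfolding Cone_def by (rule subset_antisym)
qed

lemma fan_cone_generated_by_ray_gens:
  assumes "is_fan \<Sigma>" "\<sigma> \<in> \<Sigma>"
  shows "\<sigma> = convex_cone hull (ray_gen ` cone_rays \<sigma>)"
proof -
  have "rational_cone \<sigma>" and sc: "strongly_convex \<sigma>" using assms unfolding is_fan_def by simp_all
  then obtain S where S: "finite S" "\<sigma> = convex_cone hull S" unfolding rational_cone_def by auto
  have "\<sigma> = Cone (cone_rays \<sigma>)" unfolding Cone_def by (rule pointed_cone_generated_by_rays[OF S sc])
  also have "\<dots> = convex_cone hull (ray_gen ` cone_rays \<sigma>)"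
    by (rule Cone_eq_hull_ray_gens[OF assms(1) cone_rays_subset_fan_rays[OF assms]])
  finally show ?thesis .
qed

text \<open>The generators of \<open>\<sigma>\<close> are independent, so any subset of them spans a
  face, and a fan contains the nonempty faces of its cones. For two rays: if
  \<open>Cone {\<alpha>, \<alpha>'}\<close> is missing, no cone of the fan has both as rays.\<close>

lemma Cone_of_rays_in_simplicial_fan:
  assumes "is_fan \<Sigma>" "simplicial_fan \<Sigma>" "\<sigma> \<in> \<Sigma>" "A \<subseteq> cone_rays \<sigma>"
  shows "Cone A \<in> \<Sigma>"
proof -
  have "A \<subseteq> fan_rays \<Sigma>" using assms cone_rays_subset_fan_rays by blast
  then have eq: "Cone A = convex_cone hull (ray_gen ` A)" using assms(1) by (intro Cone_eq_hull_ray_gens)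
  have "Cone A face_of \<sigma>"
    unfolding eq
    by (subst fan_cone_generated_by_ray_gens[OF assms(1,3)], rule convex_cone_hull_face_of)
      (use assms in \<open>auto simp: simplicial_fan_def\<close>)
  moreover have "Cone A \<noteq> {}" unfolding Cone_def by (rule convex_cone_hull_nonempty)
  ultimately show ?thesis using assms(1,3) unfolding is_fan_def by blast
qed

section \<open>Cartier data and intersection numbers\<close>

text \<open>\<open>Cartier_data\<close> imposes its linear equations cone by cone, and independence
  of the generators makes them solvable on each cone over the reals.\<close>

lemma torus_divisor_Cartier:
  assumes "is_fan \<Sigma>" "simplicial_fan \<Sigma>" "D \<in> torus_divisors \<Sigma>"
  shows "D \<in> Cartier_divisors \<Sigma>"
proof -
  have "\<exists>m. \<forall>\<rho>\<in>cone_rays \<sigma>. m \<bullet> ray_gen \<rho> = - D \<rho>" if "\<sigma> \<in> \<Sigma>" for \<sigma>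
  proof -
    have inj: "inj_on ray_gen (cone_rays \<sigma>)"
      using inj_on_ray_gen cone_rays_subset_fan_rays assms(1) that by (metis inj_on_subset)
    have "independent (ray_gen ` cone_rays \<sigma>)" using assms(2) that unfolding simplicial_fan_def by blast
    \<comment> \<open>Values are prescribed on vectors while \<open>D\<close> is indexed by rays;
      injectivity of \<open>ray_gen\<close> on the rays of \<open>\<sigma>\<close> lets
      \<open>inv_into\<close> recover the ray.\<close>
    then obtain m where "\<And>b. b \<in> ray_gen ` cone_rays \<sigma> \<Longrightarrow> m \<bullet> b = - D (inv_into (cone_rays \<sigma>) ray_gen b)"
      using independent_prescribed_inner[where f = "\<lambda>b. - D (inv_into (cone_rays \<sigma>) ray_gen b)"] by metis
    then show ?thesis using inj by (intro exI[of _ m]) simp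
  qed
  then have "\<exists>m. \<forall>\<sigma>\<in>\<Sigma>. \<forall>\<rho>\<in>cone_rays \<sigma>. m \<sigma> \<bullet> ray_gen \<rho> = - D \<rho>" by (intro bchoice) blast
  then show ?thesis
    using assms(3) unfolding Cartier_divisors_def Cartier_data_def max_cones_def by blast
qed

text \<open>The wall has all ray generators of \<open>\<sigma>\<close> but one, and that one plays
  the role of \<open>b0\<close> in the lattice lemma. The lift is needed for the existence half of
  the description in \<open>intersection_number\<close>.\<close>

lemma exists_lifts_quotient_gen:
  fixes \<Sigma> :: "(real ^ 'n) set set"
  assumes "is_fan \<Sigma>" "simplicial_fan \<Sigma>" "\<sigma> \<in> max_cones \<Sigma>" "\<tau> \<in> walls \<Sigma>" "\<tau> face_of \<sigma>"
  shows "\<exists>u. lifts_quotient_gen \<sigma> \<tau> u"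
proof -
  define A B where "A = ray_gen ` cone_rays \<tau>" and "B = ray_gen ` cone_rays \<sigma>"
  have in\<Sigma>: "\<sigma> \<in> \<Sigma>" "\<tau> \<in> \<Sigma>" using assms(3,4) unfolding max_cones_def walls_def by auto
  have ind: "independent A" "independent B"
    using assms(2) in\<Sigma> unfolding simplicial_fan_def A_def B_def by auto
  have hull: "\<sigma> = convex_cone hull B" "\<tau> = convex_cone hull A"
    using fan_cone_generated_by_ray_gens[OF assms(1)] in\<Sigma> unfolding A_def B_def by auto
  have "A \<subseteq> B"
    using face_of_trans[OF _ assms(5)] unfolding A_def B_def cone_rays_def by blast
  \<comment> \<open>By independence the dimensions of \<open>\<sigma>\<close> and
    \<open>\<tau>\<close> count their generators.\<close>
  have "card B = CARD('n)" "card A + 1 = CARD('n)"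
    using assms(3,4) hull ind unfolding max_cones_def walls_def
    by (metis (mono_tags, lifting) dim_span dim_span_eq_card_independent mem_Collect_eq span_convex_cone_hull)+
  moreover have "finite A" using ind independent_bound by blast
  ultimately have "card (B - A) = 1" using \<open>A \<subseteq> B\<close> by (simp add: card_Diff_subset)
  then obtain b where b: "B - A = {b}" by (rule card_1_singletonE)
  then have bB: "b \<in> B" "B - {b} = A" using \<open>A \<subseteq> B\<close> by auto
  have "B \<subseteq> lattice_points"
    using fan_ray_generator(1)[OF assms(1)] cone_rays_subset_fan_rays[OF assms(1) in\<Sigma>(1)]
    unfolding B_def by blast
  then obtain u where "u \<in> \<sigma>" "u \<in> lattice_points" "u \<notin> span A"
    "\<And>v. v \<in> \<sigma> \<inter> lattice_points \<Longrightarrow> \<exists>k::nat. v - real k *\<^sub>R u \<in> span A"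
    using exists_lift_of_quotient_generator[OF ind(2) _ bB(1)] unfolding bB(2) hull(1) by metis
  moreover have "span \<tau> = span A" using hull(2) span_convex_cone_hull by metis
  ultimately show ?thesis unfolding lifts_quotient_gen_def by auto
qed

text \<open>The generators span the whole space because \<open>\<sigma>\<close> has full dimension,
  and \<open>m \<sigma>\<close> is orthogonal to each of them, hence to itself.\<close>

lemma Cartier_data_eq_0:
  fixes \<Sigma> :: "(real ^ 'n) set set"
  assumes "is_fan \<Sigma>" "\<sigma> \<in> max_cones \<Sigma>" "Cartier_data \<Sigma> D m" "\<And>\<rho>. \<rho> \<in> cone_rays \<sigma> \<Longrightarrow> D \<rho> = 0"
  shows "m \<sigma> = 0"
proof -
  define B where "B = ray_gen ` cone_rays \<sigma>"
  have "\<sigma> = convex_cone hull B"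
    using fan_cone_generated_by_ray_gens[OF assms(1)] assms(2) unfolding B_def max_cones_def by auto
  then have "span B = span \<sigma>" by (metis span_convex_cone_hull)
  also have "\<dots> = UNIV" using assms(2) dim_eq_full[of \<sigma>] unfolding max_cones_def by simp
  finally have "m \<sigma> \<in> span B" by simp
  then have "m \<sigma> \<bullet> m \<sigma> = 0"
  proof (rule span_induct[where P = "\<lambda>x. m \<sigma> \<bullet> x = 0"])
    show "m \<sigma> \<bullet> b = 0" if "b \<in> B" for b
      using that assms unfolding Cartier_data_def B_def by auto
  qed (rule subspace_hyperplane)
  then show ?thesis by simp
qed

text \<open>The description in \<open>intersection_number\<close> ranges over all pairs of maximal
  cones meeting in \<open>\<tau>\<close>, all Cartier data and all lifts. For uniqueness every such
  choice must give 0, which is why the vanishing of \<open>D\<close> is assumed on each maximal cone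
  with face \<open>\<tau>\<close>.\<close>

lemma intersection_number_eq_0:
  assumes "is_fan \<Sigma>" "simplicial_fan \<Sigma>" "D \<in> torus_divisors \<Sigma>"
    and wall: "\<sigma> \<in> max_cones \<Sigma>" "\<sigma>' \<in> max_cones \<Sigma>" "\<tau> = \<sigma> \<inter> \<sigma>'" "\<tau> \<in> walls \<Sigma>"
    and D: "\<And>\<gamma> \<rho>. \<gamma> \<in> max_cones \<Sigma> \<Longrightarrow> \<tau> face_of \<gamma> \<Longrightarrow> \<rho> \<in> cone_rays \<gamma> \<Longrightarrow> D \<rho> = 0"
  shows "intersection_number \<Sigma> D \<tau> = 0"
proof -
  have face: "\<gamma> \<inter> \<gamma>' face_of \<gamma>" "\<gamma> \<inter> \<gamma>' face_of \<gamma>'"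
    if "\<gamma> \<in> max_cones \<Sigma>" "\<gamma>' \<in> max_cones \<Sigma>" for \<gamma> \<gamma>'
    using that assms(1) unfolding is_fan_def max_cones_def by simp_all
  have zero: "m \<gamma> = 0" if "Cartier_data \<Sigma> D m" "\<gamma> \<in> max_cones \<Sigma>" "\<tau> face_of \<gamma>" for m \<gamma>
    by (rule Cartier_data_eq_0[OF assms(1) that(2,1) D[OF that(2,3)]])
  obtain m where m: "Cartier_data \<Sigma> D m"
    using torus_divisor_Cartier[OF assms(1-3)] unfolding Cartier_divisors_def by blast
  obtain u where u: "lifts_quotient_gen \<sigma>' \<tau> u"
    using exists_lifts_quotient_gen[OF assms(1,2)] wall face by blast
  \<comment> \<open>Otherwise \<open>\<tau>\<close> would equal \<open>\<sigma>\<close> and have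
    full dimension instead of one less.\<close>
  have "\<sigma> \<noteq> \<sigma>'" using wall unfolding max_cones_def walls_def by auto
  have "m \<sigma> = 0" "m \<sigma>' = 0" using zero[OF m] wall face by blast+
  then have "0 = (m \<sigma> - m \<sigma>') \<bullet> u" by simp
  then show ?thesis
    unfolding intersection_number_def
  proof (intro the_equality)
    show "\<exists>\<sigma>\<in>max_cones \<Sigma>. \<exists>\<sigma>'\<in>max_cones \<Sigma>. \<exists>m u. \<sigma> \<noteq> \<sigma>' \<and> \<tau> = \<sigma> \<inter> \<sigma>' \<and>
        Cartier_data \<Sigma> D m \<and> lifts_quotient_gen \<sigma>' \<tau> u \<and> 0 = (m \<sigma> - m \<sigma>') \<bullet> u"
      using wall \<open>\<sigma> \<noteq> \<sigma>'\<close> m u \<open>0 = _\<close> by blast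
  next
    fix x
    assume "\<exists>\<sigma>\<in>max_cones \<Sigma>. \<exists>\<sigma>'\<in>max_cones \<Sigma>. \<exists>m u. \<sigma> \<noteq> \<sigma>' \<and> \<tau> = \<sigma> \<inter> \<sigma>' \<and>
        Cartier_data \<Sigma> D m \<and> lifts_quotient_gen \<sigma>' \<tau> u \<and> x = (m \<sigma> - m \<sigma>') \<bullet> u"
    then obtain \<gamma> \<gamma>' m u where "\<gamma> \<in> max_cones \<Sigma>" "\<gamma>' \<in> max_cones \<Sigma>" "\<tau> = \<gamma> \<inter> \<gamma>'"
      "Cartier_data \<Sigma> D m" and x: "x = (m \<gamma> - m \<gamma>') \<bullet> u" by blast
    then have "m \<gamma> = 0" "m \<gamma>' = 0" using zero face by blast+
    then show "x = 0" using x by simp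
  qed
qed

section \<open>Transfer of the vanishing degree from \<open>\<tau>\<close> to
  \<open>\<tau>'\<close>\<close>

theorem corollary3p5:
  fixes \<Sigma> :: "(real ^ 'n) set set"
    and \<sigma> \<sigma>' \<tau> \<tau>' \<alpha> \<alpha>' :: "(real ^ 'n) set"
  assumes dim: "CARD('n) \<ge> 4"
    and fan: "is_fan \<Sigma>" "simplicial_fan \<Sigma>" "complete_fan \<Sigma>" "locally_convex_fan \<Sigma>"
    and wall: "\<sigma> \<in> max_cones \<Sigma>" "\<sigma>' \<in> max_cones \<Sigma>" "\<tau> = \<sigma> \<inter> \<sigma>'" "\<tau> \<in> walls \<Sigma>"
    and alpha: "\<alpha> \<in> cone_rays \<tau>" "intersection_number \<Sigma> (ray_divisor \<alpha>) \<tau> = 0"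
    and alpha': "\<alpha>' \<in> fan_rays \<Sigma>"
    and subst: "substitute_ray \<sigma> \<alpha> \<alpha>' \<in> \<Sigma>" "substitute_ray \<sigma>' \<alpha> \<alpha>' \<in> \<Sigma>"
    and tau': "\<tau>' = Cone {opposite_face \<tau> \<alpha>, \<alpha>'}"
    and ray_of_class: "curve_class \<Sigma> \<tau>' \<in> nonneg_multiples (curve_class \<Sigma> \<tau>)"
    and cycle: "induced_4_cycle \<Sigma> \<alpha> (opposite_ray \<sigma> \<tau>) \<alpha>' (opposite_ray \<sigma>' \<tau>)"
  shows "intersection_number \<Sigma> (ray_divisor \<alpha>') \<tau>' = 0"
proof -
  define D :: "'n divisor" where "D = ray_divisor \<alpha>'"
  have D: "D \<in> torus_divisors \<Sigma>"
    using alpha' unfolding D_def torus_divisors_def ray_divisor_def by auto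
  have "\<alpha>' \<notin> cone_rays \<gamma>" if \<gamma>: "\<gamma> \<in> max_cones \<Sigma>" "\<tau> face_of \<gamma>" for \<gamma>
  proof
    assume "\<alpha>' \<in> cone_rays \<gamma>"
    moreover have "\<alpha> \<in> cone_rays \<gamma>"
      using alpha(1) face_of_trans[OF _ \<gamma>(2)] unfolding cone_rays_def by simp
    ultimately have "{\<alpha>, \<alpha>'} \<subseteq> cone_rays \<gamma>" by simp
    moreover have "\<gamma> \<in> \<Sigma>" using \<gamma>(1) unfolding max_cones_def by simp
    ultimately have "Cone {\<alpha>, \<alpha>'} \<in> \<Sigma>" by (intro Cone_of_rays_in_simplicial_fan[OF fan(1,2)])
    moreover have "Cone {\<alpha>, \<alpha>'} \<notin> \<Sigma>" using cycle unfolding induced_4_cycle_def by (elim conjE)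
    ultimately show False by contradiction
  qed
  then have "intersection_number \<Sigma> D \<tau> = 0"
    by (intro intersection_number_eq_0[OF fan(1,2) D wall]) (metis D_def ray_divisor_def)
  \<comment> \<open>\<open>curve_class\<close> has the default value 0 off the Cartier divisors;
    this membership ensures that both classes evaluate at \<open>D\<close> to actual intersection
    numbers.\<close>
  moreover have "D \<in> Cartier_divisors \<Sigma>" by (rule torus_divisor_Cartier[OF fan(1,2) D])
  moreover obtain t where "curve_class \<Sigma> \<tau>' D = t * curve_class \<Sigma> \<tau> D"
    using ray_of_class unfolding nonneg_multiples_def mem_Collect_eq by metis
  ultimately show ?thesis unfolding curve_class_def D_def by (metis mult_zero_right)
qed

end
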